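(* Let $\psi$ be a pseudo-symmetric relative positional encoding (RPE). Then two featured graphs $(G,X_G)$ and $(H,X_H)$ are $\psi$-WL indistinguishable if and only if they are $\psi$-2-WL indistinguishable.
   Context: Graphs are finite and unweighted (directed or undirected). A featured graph $(G,X_G)$ is a graph with node features $X_G:V_G\to\mathbb{R}^d$. Double braces denote multisets. An RPE $\psi$ assigns each graph $G$ a map $\psi_G:V_G\times V_G\to\mathbb{R}^k$ such that $\psi_G=\psi_H\circ(\sigma\times\sigma)$ for every graph isomorphism $\sigma:V_G\to V_H$. An RPE $\psi$ with values in $\mathbb{R}^k$ is pseudo-symmetric if there is an injective function $f:\mathbb{R}^k\to\mathbb{R}^k$ with $f\circ f=\mathrm{Id}$ such that $\psi_G(u,v)=f(\psi_G(v,u))$ for every graph $G$ and all $u,v\in V_G$. $\psi$-WL: $\chi^{(0)}_{\psi_G}(v)=X_G(v)$ and $\chi^{(t+1)}_{\psi_G}(v)=\big(\chi^{(t)}_{\psi_G}(v),\{\!\{(\chi^{(t)}_{\psi_G}(u),\psi_G(v,u)):u\in V_G\}\!\}\big)$ for $t\ge0$. Two featured graphs are $\psi$-WL indistinguishable if $\{\!\{\chi^{(t)}_{\psi_G}(v):v\in V_G\}\!\}=\{\!\{\chi^{(t)}_{\psi_H}(x):x\in V_H\}\!\}$ for all $t\ge0$. $\psi$-2-WL: $\chi^{(0)}_{2,\psi_G}(u,v)=(X_G(u),X_G(v),\psi_G(u,v))$ and $\chi^{(t+1)}_{2,\psi_G}(u,v)=\big(\chi^{(t)}_{2,\psi_G}(u,v),\{\!\{\chi^{(t)}_{2,\psi_G}(u,w):w\in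 V_G\}\!\},\{\!\{\chi^{(t)}_{2,\psi_G}(w,v):w\in V_G\}\!\}\big)$. Two featured graphs are $\psi$-2-WL indistinguishable if $\{\!\{\chi^{(t)}_{2,\psi_G}(u,v):u,v\in V_G\}\!\}=\{\!\{\chi^{(t)}_{2,\psi_H}(x,y):x,y\in V_H\}\!\}$ for all $t\ge0$. *)

theory Defs
  imports
    "HOL-Analysis.Finite_Cartesian_Product"
    "HOL-Library.Multiset"
    "Graph_Theory.Pair_Digraph"
begin

text \<open>
  A finite unweighted graph is a record \<open>G :: 'v pair_pre_digraph\<close> with vertex set \<open>pverts G\<close> and
  arc set \<open>parcs G \<subseteq> pverts G \<times> pverts G\<close>; undirected graphs are those with a symmetric arc set.
  The collection of graphs on which a positional encoding is defined is one of the following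
  four: directed or undirected graphs, with loops permitted or forbidden.
\<close>

definition graph_classes :: "('v pair_pre_digraph \<Rightarrow> bool) set" where
  "graph_classes = {pair_fin_digraph, pair_digraph, pair_pseudo_graph, pair_graph}"

definition graph_isomorphism ::
    "('v \<Rightarrow> 'v) \<Rightarrow> 'v pair_pre_digraph \<Rightarrow> 'v pair_pre_digraph \<Rightarrow> bool" where
  "graph_isomorphism \<sigma> G H \<longleftrightarrow>
     bij_betw \<sigma> (pverts G) (pverts H) \<and>
     (\<forall>u\<in>pverts G. \<forall>v\<in>pverts G. (u, v) \<in> parcs G \<longleftrightarrow> (\<sigma> u, \<sigma> v) \<in> parcs H)"

text \<open>
  The map \<open>\<psi> G\<close> is a total function, but only its values on \<open>pverts G \<times> pverts G\<close> for \<open>G\<close> in the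
  class \<open>C\<close> are meaningful; nothing is required of, or read from, the other values. The same holds
  for node features \<open>X\<close> outside \<open>pverts G\<close>.
\<close>

type_synonym ('v, 'k) encoding = "'v pair_pre_digraph \<Rightarrow> 'v \<Rightarrow> 'v \<Rightarrow> real ^ 'k"

definition rpe :: "('v pair_pre_digraph \<Rightarrow> bool) \<Rightarrow> ('v, 'k::finite) encoding \<Rightarrow> bool" where
  "rpe C \<psi> \<longleftrightarrow>
     (\<forall>G H \<sigma>. C G \<longrightarrow> C H \<longrightarrow> graph_isomorphism \<sigma> G H \<longrightarrow>
        (\<forall>u\<in>pverts G. \<forall>v\<in>pverts G. \<psi> G u v = \<psi> H (\<sigma> u) (\<sigma> v)))"

definition pseudo_symmetric ::
    "('v pair_pre_digraph \<Rightarrow> bool) \<Rightarrow> ('v, 'k::finite) encoding \<Rightarrow> bool" where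
  "pseudo_symmetric C \<psi> \<longleftrightarrow>
     (\<exists>f :: real ^ 'k \<Rightarrow> real ^ 'k. inj f \<and> f \<circ> f = id \<and>
        (\<forall>G. C G \<longrightarrow> (\<forall>u\<in>pverts G. \<forall>v\<in>pverts G. \<psi> G u v = f (\<psi> G v u))))"

text \<open>
  Colours are the nested tuples and multisets themselves. As their nesting depth grows with the
  iteration, they are collected in a datatype with one constructor for the initial colours and
  one for the tuples formed in a refinement step; no hashing or relabelling takes place.
\<close>

datatype ('x, 'p) wl_colour =
    Init 'x
  | Refine "('x, 'p) wl_colour" "(('x, 'p) wl_colour \<times> 'p) multiset"

datatype ('x, 'p) wl2_colour =
    Init2 "'x \<times> 'x \<times> 'p"
  | Refine2 "('x, 'p) wl2_colour" "('x, 'p) wl2_colour multiset" "('x, 'p) wl2_colour multiset"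

fun wl :: "('v, 'k::finite) encoding \<Rightarrow> 'v pair_pre_digraph \<Rightarrow> ('v \<Rightarrow> real ^ 'd) \<Rightarrow> nat \<Rightarrow>
    'v \<Rightarrow> (real ^ 'd, real ^ 'k) wl_colour" where
  "wl \<psi> G X 0 v = Init (X v)"
| "wl \<psi> G X (Suc t) v =
     Refine (wl \<psi> G X t v) {#(wl \<psi> G X t u, \<psi> G v u). u \<in># mset_set (pverts G)#}"

fun wl2 :: "('v, 'k::finite) encoding \<Rightarrow> 'v pair_pre_digraph \<Rightarrow> ('v \<Rightarrow> real ^ 'd) \<Rightarrow> nat \<Rightarrow>
    'v \<Rightarrow> 'v \<Rightarrow> (real ^ 'd, real ^ 'k) wl2_colour" where
  "wl2 \<psi> G X 0 u v = Init2 (X u, X v, \<psi> G u v)"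
| "wl2 \<psi> G X (Suc t) u v =
     Refine2 (wl2 \<psi> G X t u v)
       {#wl2 \<psi> G X t u w. w \<in># mset_set (pverts G)#}
       {#wl2 \<psi> G X t w v. w \<in># mset_set (pverts G)#}"

definition wl_indistinguishable ::
    "('v, 'k::finite) encoding \<Rightarrow> 'v pair_pre_digraph \<Rightarrow> ('v \<Rightarrow> real ^ 'd) \<Rightarrow>
     'v pair_pre_digraph \<Rightarrow> ('v \<Rightarrow> real ^ 'd) \<Rightarrow> bool" where
  "wl_indistinguishable \<psi> G X H Y \<longleftrightarrow>
     (\<forall>t. {#wl \<psi> G X t v. v \<in># mset_set (pverts G)#} =
          {#wl \<psi> H Y t x. x \<in># mset_set (pverts H)#})"

definition wl2_indistinguishable ::
    "('v, 'k::finite) encoding \<Rightarrow> 'v pair_pre_digraph \<Rightarrow> ('v \<Rightarrow> real ^ 'd) \<Rightarrow>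
     'v pair_pre_digraph \<Rightarrow> ('v \<Rightarrow> real ^ 'd) \<Rightarrow> bool" where
  "wl2_indistinguishable \<psi> G X H Y \<longleftrightarrow>
     (\<forall>t. {#wl2 \<psi> G X t u v. (u, v) \<in># mset_set (pverts G \<times> pverts G)#} =
          {#wl2 \<psi> H Y t x y. (x, y) \<in># mset_set (pverts H \<times> pverts H)#})"

end

theory Submission
  imports Defs
begin

text \<open>
  Both algorithms carry the same information: the \<open>\<psi>\<close>-2-WL colour of \<open>(u, v)\<close> in round \<open>t\<close> and the
  triple of the \<open>\<psi>\<close>-WL colours of \<open>u\<close> and \<open>v\<close> in round \<open>t\<close> and \<open>\<psi> u v\<close> are computed from one
  another by maps that do not depend on the graph. The involution \<open>f\<close> of pseudo-symmetry turns the
  column multiset at \<open>v\<close>, which sees \<open>\<psi> w v\<close>, into a row multiset, which sees \<open>\<psi> v w\<close>. The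
  multiset of all pair colours in round \<open>t\<close> is thus a function of the \<open>\<psi>\<close>-WL histogram in round
  \<open>t + 1\<close>; conversely, it yields \<open>n\<close> copies of the \<open>\<psi>\<close>-WL histogram in round \<open>t\<close> for a graph
  with \<open>n\<close> vertices, and \<open>n\<close> can be cancelled.
\<close>

text \<open>The round number drives the recursion. Colours of round \<open>t\<close> carry exactly
  \<open>t\<close> layers of \<open>Refine\<close>, so the \<open>undefined\<close> clause is never
  reached on them. The entries \<open>q\<close> of \<open>N\<close> are \<psi>-values from the
  second vertex, whence \<open>f q\<close> for the column.\<close>

fun wl2_of_wl :: "('p \<Rightarrow> 'p) \<Rightarrow> nat \<Rightarrow> ('x, 'p) wl_colour \<Rightarrow> ('x, 'p) wl_colour \<Rightarrow> 'p \<Rightarrow>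
    ('x, 'p) wl2_colour" where
  "wl2_of_wl f 0 (Init x) (Init y) p = Init2 (x, y, p)"
| "wl2_of_wl f (Suc t) (Refine a M) (Refine b N) p =
     Refine2 (wl2_of_wl f t a b p)
       {#wl2_of_wl f t a c q. (c, q) \<in># M#}
       {#wl2_of_wl f t c b (f q). (c, q) \<in># N#}"
| "wl2_of_wl f _ _ _ _ = undefined"

text \<open>A row at \<open>u\<close> keeps the second vertex of each pair together with the pair's
  encoding; a column at \<open>v\<close> keeps the first vertex, with the encoding reversed by
  \<open>f\<close>.\<close>

primrec wl_of_wl2 :: "('p \<Rightarrow> 'p) \<Rightarrow> ('x, 'p) wl2_colour \<Rightarrow>
    ('x, 'p) wl_colour \<times> ('x, 'p) wl_colour \<times> 'p" where
  "wl_of_wl2 f (Init2 z) = (case z of (x, y, p) \<Rightarrow> (Init x, Init y, p))"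
| "wl_of_wl2 f (Refine2 c R S) = (case wl_of_wl2 f c of (a, b, p) \<Rightarrow>
     (Refine a (image_mset snd (image_mset (wl_of_wl2 f) R)),
      Refine b (image_mset (\<lambda>(c, _, q). (c, f q)) (image_mset (wl_of_wl2 f) S)),
      p))"

lemma wl2_eq_wl2_of_wl:
  assumes f: "\<forall>u\<in>pverts G. \<forall>v\<in>pverts G. \<psi> G u v = f (\<psi> G v u)"
    and "u \<in> pverts G" "v \<in> pverts G"
  shows "wl2 \<psi> G X t u v = wl2_of_wl f t (wl \<psi> G X t u) (wl \<psi> G X t v) (\<psi> G u v)"
  using assms(2,3)
proof (induction t arbitrary: u v)
  case 0
  then show ?case by simp
next
  case (Suc t)
  \<comment> \<open>For infinite \<open>pverts G\<close> the multiset
    \<open>mset_set (pverts G)\<close> is empty by convention, so the claim is vacuous.\<close>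
  have mem: "w \<in> pverts G" if "w \<in># mset_set (pverts G)" for w
    using that by (cases "finite (pverts G)") auto
  have flip: "f (\<psi> G v w) = \<psi> G w v" if "w \<in> pverts G" for w
    using f Suc.prems(2) that by metis
  have "{#wl2 \<psi> G X t u w. w \<in># mset_set (pverts G)#} =
      {#wl2_of_wl f t (wl \<psi> G X t u) (wl \<psi> G X t w) (\<psi> G u w). w \<in># mset_set (pverts G)#}"
    using Suc mem by (intro image_mset_cong) auto
  moreover have "{#wl2 \<psi> G X t w v. w \<in># mset_set (pverts G)#} =
      {#wl2_of_wl f t (wl \<psi> G X t w) (wl \<psi> G X t v) (f (\<psi> G v w)). w \<in># mset_set (pverts G)#}"
    using Suc mem flip by (intro image_mset_cong) auto
  ultimately show ?case
    using Suc by (simp add: image_mset.compositionality comp_def)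
qed

lemma wl_of_wl2_wl2:
  assumes f: "\<forall>u\<in>pverts G. \<forall>v\<in>pverts G. \<psi> G u v = f (\<psi> G v u)"
    and "u \<in> pverts G" "v \<in> pverts G"
  shows "wl_of_wl2 f (wl2 \<psi> G X t u v) = (wl \<psi> G X t u, wl \<psi> G X t v, \<psi> G u v)"
  using assms(2,3)
proof (induction t arbitrary: u v)
  case 0
  then show ?case by simp
next
  case (Suc t)
  have mem: "w \<in> pverts G" if "w \<in># mset_set (pverts G)" for w
    using that by (cases "finite (pverts G)") auto
  have flip: "f (\<psi> G w v) = \<psi> G v w" if "w \<in> pverts G" for w
    using f Suc.prems(2) that by metis
  have "{#snd (wl_of_wl2 f (wl2 \<psi> G X t u w)). w \<in># mset_set (pverts G)#} =
      {#(wl \<psi> G X t w, \<psi> G u w). w \<in># mset_set (pverts G)#}"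
    using Suc mem by (intro image_mset_cong) auto
  moreover have "{#case wl_of_wl2 f (wl2 \<psi> G X t w v) of (c, _, q) \<Rightarrow> (c, f q).
        w \<in># mset_set (pverts G)#} =
      {#(wl \<psi> G X t w, \<psi> G v w). w \<in># mset_set (pverts G)#}"
    using Suc mem flip by (intro image_mset_cong) auto
  ultimately show ?case
    using Suc by (simp add: image_mset.compositionality comp_def)
qed

lemma image_mset_mset_set_Times:
  assumes "finite A" "finite B"
  shows "{#g u v. (u, v) \<in># mset_set (A \<times> B)#} =
    (\<Sum>u\<in>#mset_set A. {#g u v. v \<in># mset_set B#})"
  using assms(1)
proof (induction rule: finite_induct)
  case empty
  then show ?case by simp
next
  case (insert a A)
  \<comment> \<open>The row at \<open>a\<close> is split off; it is disjoint from the remaining rows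
    because \<open>a\<close> is new.\<close>
  have "mset_set (insert a A \<times> B) = mset_set ((Pair a ` B) \<union> A \<times> B)"
    by (rule arg_cong[where f = mset_set]) auto
  also have "\<dots> = mset_set (Pair a ` B) + mset_set (A \<times> B)"
    using insert assms by (intro mset_set_Union) auto
  also have "mset_set (Pair a ` B) = image_mset (Pair a) (mset_set B)"
    by (simp add: image_mset_mset_set inj_on_def)
  finally show ?case
    using insert by (simp add: image_mset.compositionality comp_def)
qed

text \<open>The pair colours are summed row by row. One extra \<psi>-WL round is spent because the
  colour of \<open>u\<close> in round \<open>Suc t\<close> lists all round-\<open>t\<close> colours
  next to their encodings from \<open>u\<close>, which is the data of the row at
  \<open>u\<close>.\<close>

lemma wl2_histogram_eq:
  assumes f: "\<forall>u\<in>pverts G. \<forall>v\<in>pverts G. \<psi> G u v = f (\<psi> G v u)"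
    and fin: "finite (pverts G)"
  shows "{#wl2 \<psi> G X t u v. (u, v) \<in># mset_set (pverts G \<times> pverts G)#} =
    (\<Sum>c\<in>#{#wl \<psi> G X (Suc t) u. u \<in># mset_set (pverts G)#}.
      case c of Refine a M \<Rightarrow> {#wl2_of_wl f t a b q. (b, q) \<in># M#})"
proof -
  have "(\<Sum>u\<in>#mset_set (pverts G). {#wl2 \<psi> G X t u v. v \<in># mset_set (pverts G)#}) =
      (\<Sum>u\<in>#mset_set (pverts G).
        {#wl2_of_wl f t (wl \<psi> G X t u) (wl \<psi> G X t v) (\<psi> G u v). v \<in># mset_set (pverts G)#})"
    using fin wl2_eq_wl2_of_wl[of G \<psi> f _ _ X, OF f]
    by (intro arg_cong[where f = sum_mset] image_mset_cong) auto
  then show ?thesis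
    using fin
    by (simp add: image_mset_mset_set_Times image_mset.compositionality comp_def)
qed

lemma sum_mset_replicate_mset_eq_repeat_mset: "\<Sum>\<^sub># (replicate_mset n M) = repeat_mset n M"
  by (induction n) simp_all

text \<open>Reading off the second vertex of every pair meets each vertex once per choice of the
  first.\<close>

lemma repeat_mset_wl_histogram:
  assumes f: "\<forall>u\<in>pverts G. \<forall>v\<in>pverts G. \<psi> G u v = f (\<psi> G v u)"
    and fin: "finite (pverts G)"
  shows "repeat_mset (card (pverts G)) {#wl \<psi> G X t v. v \<in># mset_set (pverts G)#} =
    {#fst (snd (wl_of_wl2 f c)).
      c \<in># {#wl2 \<psi> G X t u v. (u, v) \<in># mset_set (pverts G \<times> pverts G)#}#}"
proof -
  have "{#fst (snd (wl_of_wl2 f c)).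
        c \<in># {#wl2 \<psi> G X t u v. (u, v) \<in># mset_set (pverts G \<times> pverts G)#}#} =
      {#wl \<psi> G X t v. (u, v) \<in># mset_set (pverts G \<times> pverts G)#}"
    using fin wl_of_wl2_wl2[of G \<psi> f _ _ X, OF f]
    by (auto simp: image_mset.compositionality comp_def intro!: image_mset_cong)
  also have "\<dots> = (\<Sum>u\<in>#mset_set (pverts G). {#wl \<psi> G X t v. v \<in># mset_set (pverts G)#})"
    using fin by (rule image_mset_mset_set_Times) (fact fin)
  also have "\<dots> = repeat_mset (card (pverts G)) {#wl \<psi> G X t v. v \<in># mset_set (pverts G)#}"
    by (simp add: image_mset_const_eq sum_mset_replicate_mset_eq_repeat_mset)
  finally show ?thesis ..
qed

theorem theorem3p5:
  fixes C :: "'v pair_pre_digraph \<Rightarrow> bool"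
    and \<psi> :: "'v pair_pre_digraph \<Rightarrow> 'v \<Rightarrow> 'v \<Rightarrow> real ^ 'k::finite"
    and G H :: "'v pair_pre_digraph"
    and X\<^sub>G X\<^sub>H :: "'v \<Rightarrow> real ^ 'd::finite"
  assumes "C \<in> graph_classes"
    and "rpe C \<psi>"
    and "pseudo_symmetric C \<psi>"
    and "C G" and "C H"
  shows "wl_indistinguishable \<psi> G X\<^sub>G H X\<^sub>H \<longleftrightarrow> wl2_indistinguishable \<psi> G X\<^sub>G H X\<^sub>H"
proof -
  have fin: "finite (pverts K)" if "C K" for K
  proof -
    have "pair_fin_digraph K"
      using assms(1) that unfolding graph_classes_def
      by (auto simp: pair_digraph_def pair_pseudo_graph_def pair_graph_def)
    then show ?thesis
      by (rule pair_fin_digraph.pair_finite_verts)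
  qed
  note finG = fin[OF \<open>C G\<close>] and finH = fin[OF \<open>C H\<close>]
  obtain f where
    "\<And>K. C K \<Longrightarrow> \<forall>u\<in>pverts K. \<forall>v\<in>pverts K. \<psi> K u v = f (\<psi> K v u)"
    using assms(3) unfolding pseudo_symmetric_def by blast
  note fG = this[OF \<open>C G\<close>] and fH = this[OF \<open>C H\<close>]
  show ?thesis
  proof
    assume "wl_indistinguishable \<psi> G X\<^sub>G H X\<^sub>H"
    then show "wl2_indistinguishable \<psi> G X\<^sub>G H X\<^sub>H"
      unfolding wl_indistinguishable_def wl2_indistinguishable_def
        wl2_histogram_eq[of G \<psi> f X\<^sub>G, OF fG finG] wl2_histogram_eq[of H \<psi> f X\<^sub>H, OF fH finH]
      by simp
  next
    assume wl2: "wl2_indistinguishable \<psi> G X\<^sub>G H X\<^sub>H"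
    \<comment> \<open>Counting pairs recovers the number of vertices, so that both graphs repeat
      their histograms equally often.\<close>
    from wl2 have "size {#wl2 \<psi> G X\<^sub>G 0 u v. (u, v) \<in># mset_set (pverts G \<times> pverts G)#} =
        size {#wl2 \<psi> H X\<^sub>H 0 x y. (x, y) \<in># mset_set (pverts H \<times> pverts H)#}"
      unfolding wl2_indistinguishable_def by metis
    then have "card (pverts G) ^ 2 = card (pverts H) ^ 2"
      by (simp add: card_cartesian_product power2_eq_square)
    then have card: "card (pverts G) = card (pverts H)"
      by simp
    have "repeat_mset (card (pverts G)) {#wl \<psi> G X\<^sub>G t v. v \<in># mset_set (pverts G)#} =
        repeat_mset (card (pverts G)) {#wl \<psi> H X\<^sub>H t x. x \<in># mset_set (pverts H)#}" for t
      using wl2 repeat_mset_wl_histogram[of G \<psi> f X\<^sub>G, OF fG finG]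
        repeat_mset_wl_histogram[of H \<psi> f X\<^sub>H, OF fH finH] card
      unfolding wl2_indistinguishable_def by metis
    \<comment> \<open>Cancelling the factor requires it to be nonzero; if it is zero, both vertex
      sets are empty.\<close>
    then show "wl_indistinguishable \<psi> G X\<^sub>G H X\<^sub>H"
      using card finG finH unfolding wl_indistinguishable_def
      by (cases "card (pverts G) = 0") (auto simp: repeat_mset_cancel1)
  qed
qed

end
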